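(* Let $b$ be an integer such that either $b\geq 3$ is odd or $b=4$, and let $n=3b$. Then $\mathrm{MiD}(L_{3,b})=\left\lfloor\frac{n-3}{2}\right\rfloor$.
   Context: A Latin square of order $n$ is an $n\times n$ array with entries from $\{1,2,\dots,n\}$ such that each row and each column contains every symbol exactly once. For positive integers $a,b$ and $n=ab$, an $(a,b)$-Sudoku Latin square is a Latin square of order $n$ such that, when the array is tiled by $a\times b$ blocks ($a$ consecutive rows $ka+1,\dots,(k+1)a$ by $b$ consecutive columns $lb+1,\dots,(l+1)b$), each block contains every symbol of $\{1,\dots,n\}$ exactly once. Two cells are adjacent if they share an edge horizontally or vertically (no wrap-around). The distance between two adjacent cells containing symbols $u,v$ is $\min\{(u-v)\bmod n,\ (v-u)\bmod n\}$, residues being taken in $\{0,\dots,n-1\}$. The inner distance of a Latin square of order $n\ge2$ is the minimum of the distances over all pairs of adjacent cells. $\mathrm{MiD}(L_{a,b})$ denotes the maximum of the inner distances of all $(a,b)$-Sudoku Latin squares. *)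

theory Defs
  imports Complex_Main
begin

text \<open>
  An array of order \<open>n\<close> is a function \<open>L\<close> from row and column indices to symbols; only its
  values at indices in \<open>{1..n}\<close> matter, and values elsewhere are arbitrary. ``Contains every
  symbol exactly once'' is expressed by \<open>bij_betw\<close> onto \<open>{1..n}\<close>.
\<close>

definition latin_square :: "nat \<Rightarrow> (nat \<Rightarrow> nat \<Rightarrow> nat) \<Rightarrow> bool" where
  "latin_square n L \<longleftrightarrow>
     (\<forall>i\<in>{1..n}. bij_betw (\<lambda>j. L i j) {1..n} {1..n}) \<and>
     (\<forall>j\<in>{1..n}. bij_betw (\<lambda>i. L i j) {1..n} {1..n})"

text \<open>
  Blocks have \<open>a\<close> rows and \<open>b\<close> columns, so for \<open>n = a * b\<close> there are \<open>b\<close> bands of blocks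
  (index \<open>k\<close>) and \<open>a\<close> stacks of blocks (index \<open>l\<close>).
\<close>

definition sudoku_latin_square :: "nat \<Rightarrow> nat \<Rightarrow> (nat \<Rightarrow> nat \<Rightarrow> nat) \<Rightarrow> bool" where
  "sudoku_latin_square a b L \<longleftrightarrow>
     latin_square (a * b) L \<and>
     (\<forall>k<b. \<forall>l<a.
        bij_betw (\<lambda>(i, j). L i j)
          ({k * a + 1..(k + 1) * a} \<times> {l * b + 1..(l + 1) * b}) {1..a * b})"

definition adjacent_cells :: "nat \<times> nat \<Rightarrow> nat \<times> nat \<Rightarrow> bool" where
  "adjacent_cells c d \<longleftrightarrow>
     (fst c = fst d \<and> (snd d = snd c + 1 \<or> snd c = snd d + 1)) \<or>
     (snd c = snd d \<and> (fst d = fst c + 1 \<or> fst c = fst d + 1))"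

text \<open>The differences are taken in \<open>int\<close>, since subtraction on \<open>nat\<close> truncates.\<close>

definition symbol_dist :: "nat \<Rightarrow> nat \<Rightarrow> nat \<Rightarrow> nat" where
  "symbol_dist n u v =
     nat (min ((int u - int v) mod int n) ((int v - int u) mod int n))"

text \<open>For \<open>n \<ge> 2\<close> the set below is finite and nonempty, so \<open>Min\<close> is the true minimum.\<close>

definition inner_distance :: "nat \<Rightarrow> (nat \<Rightarrow> nat \<Rightarrow> nat) \<Rightarrow> nat" where
  "inner_distance n L =
     Min {symbol_dist n (L i j) (L i' j') | i j i' j'.
            i \<in> {1..n} \<and> j \<in> {1..n} \<and> i' \<in> {1..n} \<and> j' \<in> {1..n} \<and>
            adjacent_cells (i, j) (i', j')}"

text \<open>
  For \<open>a * b \<ge> 2\<close> inner distances are less than \<open>a * b\<close>, so the set below is finite although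
  infinitely many functions represent the same array. It is nonempty because
  \<open>(a, b)\<close>-Sudoku Latin squares exist for all positive \<open>a\<close>, \<open>b\<close>.
\<close>

definition MiD :: "nat \<Rightarrow> nat \<Rightarrow> nat" where
  "MiD a b = Max {inner_distance (a * b) L | L. sudoku_latin_square a b L}"

end

theory Submission
  imports Defs
begin

text \<open>
  Upper bound: if \<open>a, b \<ge> 3\<close>, then some cell has all four of its neighbours inside its own block,
  so these neighbours carry four different symbols. But around the circle of \<open>n\<close> symbols
  only two (\<open>n\<close> odd) or three (\<open>n\<close> even) symbols are at distance at least
  \<open>\<lfloor>(n - 1) / 2\<rfloor>\<close> from a given one. Hence the inner distance is at most \<open>\<lfloor>(n - 3) / 2\<rfloor>\<close>
  (\<open>inner_distance_sudoku_le\<close>).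

  Lower bound: take an array \<open>L i j \<equiv> f i + g j (mod n)\<close>. Adjacent symbols then differ by
  a step of \<open>f\<close> or of \<open>g\<close>, so it suffices that all steps lie between \<open>\<lfloor>(n - 3) / 2\<rfloor>\<close> and \<open>n\<close>
  minus this number, while \<open>f\<close>, \<open>g\<close> and the sums over each block hit every residue once.

  For odd \<open>b\<close> write \<open>n = 3 b = 2 m + 1\<close> and let \<open>f\<close> make steps \<open>m\<close>, and \<open>g\<close> steps
  \<open>m - 1\<close>, with one step \<open>m\<close> whenever a block border is crossed. After multiplication by the unit
  \<open>-2\<close> modulo \<open>n\<close>, the steps \<open>m\<close> and \<open>m - 1\<close> become \<open>1\<close> and \<open>3\<close>: within a block \<open>g\<close> runs through a
  coset of the multiples of 3, and \<open>f\<close> takes three consecutive values, one in each coset, so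
  that the block is complete. The extra unit at a border moves \<open>g\<close> on to the next coset.

  For \<open>b = 4\<close> the order 12 is even and \<open>-2\<close> is no unit, but a similar pattern with rows and columns
  exchanged works: \<open>f\<close> makes steps 4, and 5 at block borders, so that it runs through a coset of
  \<open>{0, 4, 8}\<close> within a block, while \<open>g\<close> makes steps 5 and so visits every class modulo 4.
\<close>

section \<open>Circular distance and inner distance\<close>

lemma symbol_dist_commute: "symbol_dist n u v = symbol_dist n v u"
  unfolding symbol_dist_def by (simp add: min.commute)

lemma le_symbol_dist_iff:
  assumes "0 < d"
  shows "d \<le> symbol_dist n u v \<longleftrightarrow>
    int d \<le> (int v - int u) mod int n \<and> (int v - int u) mod int n \<le> int n - int d"
proof -
  define r where "r = (int v - int u) mod int n"
  have neg: "(int u - int v) mod int n = (if r = 0 then 0 else int n - r)"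
    using zmod_zminus1_eq_if[of "int v - int u" "int n"] by (simp add: r_def)
  have "d \<le> symbol_dist n u v \<longleftrightarrow>
      int d \<le> (int u - int v) mod int n \<and> int d \<le> (int v - int u) mod int n"
    unfolding symbol_dist_def using assms by (auto simp: nat_le_iff le_nat_iff min_def)
  then show ?thesis
    unfolding neg r_def[symmetric] using assms by (cases "r = 0") auto
qed

lemma finite_adjacent_dists:
  "finite {symbol_dist n (L i j) (L i' j') | i j i' j'.
     i \<in> {1..n} \<and> j \<in> {1..n} \<and> i' \<in> {1..n} \<and> j' \<in> {1..n} \<and> adjacent_cells (i, j) (i', j')}"
proof (rule finite_subset)
  show "{symbol_dist n (L i j) (L i' j') | i j i' j'.
     i \<in> {1..n} \<and> j \<in> {1..n} \<and> i' \<in> {1..n} \<and> j' \<in> {1..n} \<and> adjacent_cells (i, j) (i', j')}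
     \<subseteq> (\<lambda>(i, j, i', j'). symbol_dist n (L i j) (L i' j')) `
        ({1..n} \<times> {1..n} \<times> {1..n} \<times> {1..n})"
    by (force simp: image_iff)
qed simp

lemma inner_distance_le_symbol_dist:
  assumes "i \<in> {1..n}" "j \<in> {1..n}" "i' \<in> {1..n}" "j' \<in> {1..n}" "adjacent_cells (i, j) (i', j')"
  shows "inner_distance n L \<le> symbol_dist n (L i j) (L i' j')"
  unfolding inner_distance_def by (rule Min_le[OF finite_adjacent_dists]) (use assms in blast)

lemma le_inner_distance:
  assumes "n \<ge> 2"
    and horizontal: "\<And>i j. \<lbrakk>i \<in> {1..n}; j \<in> {1..<n}\<rbrakk> \<Longrightarrow> d \<le> symbol_dist n (L i j) (L i (j + 1))"
    and vertical: "\<And>i j. \<lbrakk>i \<in> {1..<n}; j \<in> {1..n}\<rbrakk> \<Longrightarrow> d \<le> symbol_dist n (L i j) (L (i + 1) j)"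
  shows "d \<le> inner_distance n L"
  unfolding inner_distance_def
proof (rule Min.boundedI[OF finite_adjacent_dists])
  have "adjacent_cells (1, 1) (1, 2)"
    by (simp add: adjacent_cells_def)
  then show "{symbol_dist n (L i j) (L i' j') | i j i' j'.
     i \<in> {1..n} \<and> j \<in> {1..n} \<and> i' \<in> {1..n} \<and> j' \<in> {1..n} \<and> adjacent_cells (i, j) (i', j')} \<noteq> {}"
    using assms(1) by fastforce
next
  fix x
  assume "x \<in> {symbol_dist n (L i j) (L i' j') | i j i' j'.
     i \<in> {1..n} \<and> j \<in> {1..n} \<and> i' \<in> {1..n} \<and> j' \<in> {1..n} \<and> adjacent_cells (i, j) (i', j')}"
  then obtain i j i' j' where x: "x = symbol_dist n (L i j) (L i' j')"
    and range: "i \<in> {1..n}" "j \<in> {1..n}" "i' \<in> {1..n}" "j' \<in> {1..n}"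
    and adj: "adjacent_cells (i, j) (i', j')"
    by blast
  from adj consider "i' = i" "j' = j + 1" | "i' = i" "j = j' + 1"
    | "j' = j" "i' = i + 1" | "j' = j" "i = i' + 1"
    by (auto simp: adjacent_cells_def)
  then show "d \<le> x"
  proof cases
    case 1
    then show ?thesis using horizontal[of i j] range x by simp
  next
    case 2
    then show ?thesis using horizontal[of i j'] range x by (simp add: symbol_dist_commute)
  next
    case 3
    then show ?thesis using vertical[of i j] range x by simp
  next
    case 4
    then show ?thesis using vertical[of i' j] range x by (simp add: symbol_dist_commute)
  qed
qed

section \<open>The upper bound\<close>

text \<open>
  The symbols in question form the arc opposite to \<open>c\<close>: their offsets from \<open>c\<close> range from \<open>d\<close> to
  \<open>n - d\<close>, which leaves \<open>n - 2 d + 1\<close> values.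
\<close>

lemma card_far_symbols_le:
  assumes "0 < d" "n \<le> 2 * d + 2"
  shows "card {x \<in> {1..n}. d \<le> symbol_dist n c x} \<le> 3"
proof -
  let ?S = "{x \<in> {1..n}. d \<le> symbol_dist n c x}"
  let ?r = "\<lambda>x. (int x - int c) mod int n"
  have "inj_on ?r ?S"
  proof (rule inj_onI)
    fix x y assume xy: "x \<in> ?S" "y \<in> ?S" and "?r x = ?r y"
    then have "int n dvd (int x - int c) - (int y - int c)"
      by (simp only: mod_eq_dvd_iff)
    then have "int n dvd int x - int y" by simp
    moreover have "\<bar>int x - int y\<bar> < int n" using xy by auto
    ultimately show "x = y" using dvd_imp_le_int[of "int x - int y" "int n"] by auto
  qed
  then have "card ?S = card (?r ` ?S)" by (simp add: card_image)
  also have "?r ` ?S \<subseteq> {int d..int n - int d}"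
    using le_symbol_dist_iff[OF assms(1)] by auto
  then have "card (?r ` ?S) \<le> card {int d..int n - int d}"
    by (intro card_mono) auto
  also have "\<dots> \<le> 3" using assms(2) by auto
  finally show ?thesis .
qed

lemma inner_distance_sudoku_le:
  assumes "sudoku_latin_square a b L" "a \<ge> 3" "b \<ge> 3"
  shows "inner_distance (a * b) L \<le> (a * b - 3) div 2"
proof (rule ccontr)
  define n where "n = a * b"
  define d where "d = (n - 1) div 2"
  assume "\<not> ?thesis"
  moreover have "a \<le> n" "b \<le> n" "n \<ge> 9"
    using assms(2,3) mult_le_mono[of 3 a 3 b] by (auto simp: n_def)
  ultimately have d: "0 < d" "n \<le> 2 * d + 2" "d \<le> inner_distance n L"
    by (auto simp: n_def[symmetric] d_def)
  let ?B = "{1..a} \<times> {1..b}"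
  \<comment> \<open>The neighbours of the cell \<open>(2, 2)\<close>, all in the first block.\<close>
  let ?N = "{(1, 2), (3, 2), (2, 1), (2, 3)} :: (nat \<times> nat) set"
  have "\<forall>k<b. \<forall>l<a. bij_betw (\<lambda>(i, j). L i j)
      ({k * a + 1..(k + 1) * a} \<times> {l * b + 1..(l + 1) * b}) {1..n}"
    using assms(1) by (simp add: sudoku_latin_square_def n_def)
  from this[rule_format, of 0 0] have bij: "bij_betw (\<lambda>(i, j). L i j) ?B {1..n}"
    using assms(2,3) by simp
  have sub: "?N \<subseteq> ?B" using assms(2,3) by auto
  have img: "(\<lambda>(i, j). L i j) ` ?N \<subseteq> {1..n}"
    unfolding bij_betw_imp_surj_on[OF bij, symmetric] by (rule image_mono[OF sub])
  have "inj_on (\<lambda>(i, j). L i j) ?N"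
    by (rule inj_on_subset[OF bij_betw_imp_inj_on[OF bij] sub])
  then have "card ((\<lambda>(i, j). L i j) ` ?N) = card ?N"
    by (intro card_image)
  then have four: "card ((\<lambda>(i, j). L i j) ` ?N) = 4"
    by simp
  have "d \<le> symbol_dist n (L 2 2) (L i j)" if "(i, j) \<in> ?N" for i j
  proof (rule order_trans[OF d(3) inner_distance_le_symbol_dist])
    show "adjacent_cells (2, 2) (i, j)" using that by (auto simp: adjacent_cells_def)
  qed (use that \<open>n \<ge> 9\<close> in auto)
  then have "(\<lambda>(i, j). L i j) ` ?N \<subseteq> {x \<in> {1..n}. d \<le> symbol_dist n (L 2 2) x}"
    using img by auto
  then have "4 \<le> card {x \<in> {1..n}. d \<le> symbol_dist n (L 2 2) x}"
    unfolding four[symmetric] by (intro card_mono) auto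
  with card_far_symbols_le[OF d(1,2), of "L 2 2"] show False by linarith
qed

section \<open>Additive arrays\<close>

text \<open>
  Arguments are shifted so that \<open>f\<close> and \<open>g\<close> see indices from 0, and the index of a block is a
  plain quotient.
\<close>

definition additive_array :: "nat \<Rightarrow> (nat \<Rightarrow> int) \<Rightarrow> (nat \<Rightarrow> int) \<Rightarrow> nat \<Rightarrow> nat \<Rightarrow> nat" where
  "additive_array n f g i j = nat ((f (i - 1) + g (j - 1)) mod int n) + 1"

lemma additive_array_range:
  assumes "0 < n"
  shows "additive_array n f g i j \<in> {1..n}"
proof -
  have "(f (i - 1) + g (j - 1)) mod int n < int n" using assms by simp
  then show ?thesis
    using assms unfolding additive_array_def by (auto simp: Suc_le_eq nat_less_iff)
qed

lemma additive_array_eqD: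
  assumes "0 < n" "additive_array n f g i j = additive_array n f g i' j'"
  shows "int n dvd (f (i - 1) - f (i' - 1)) + (g (j - 1) - g (j' - 1))"
proof -
  have "(f (i - 1) + g (j - 1)) mod int n = (f (i' - 1) + g (j' - 1)) mod int n"
    using assms by (simp add: additive_array_def eq_nat_nat_iff)
  then show ?thesis by (simp add: mod_eq_dvd_iff algebra_simps)
qed

lemma bij_betw_if_inj_on_card_le:
  assumes "inj_on h A" "h ` A \<subseteq> B" "finite B" "card B \<le> card A"
  shows "bij_betw h A B"
proof -
  have "h ` A = B"
    using assms by (intro card_seteq) (simp_all add: card_image)
  then show ?thesis using assms(1) by (simp add: bij_betw_def)
qed

lemma additive_array_sudoku:
  fixes f g :: "nat \<Rightarrow> int"
  assumes pos: "0 < a" "0 < b"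
    and f: "\<And>i i'. \<lbrakk>i < a * b; i' < a * b; int (a * b) dvd f i - f i'\<rbrakk> \<Longrightarrow> i = i'"
    and g: "\<And>j j'. \<lbrakk>j < a * b; j' < a * b; int (a * b) dvd g j - g j'\<rbrakk> \<Longrightarrow> j = j'"
    and block: "\<And>i j i' j'. \<lbrakk>i div a = i' div a; j div b = j' div b;
        int (a * b) dvd (f i - f i') + (g j - g j')\<rbrakk> \<Longrightarrow> i = i' \<and> j = j'"
  shows "sudoku_latin_square a b (additive_array (a * b) f g)"
proof -
  let ?n = "a * b"
  let ?L = "additive_array ?n f g"
  have n: "0 < ?n" using pos by simp
  have row: "bij_betw (\<lambda>j. ?L i j) {1..?n} {1..?n}" for i
  proof (rule bij_betw_if_inj_on_card_le)
    show "inj_on (\<lambda>j. ?L i j) {1..?n}"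
    proof (rule inj_onI)
      fix j j' assume jj: "j \<in> {1..?n}" "j' \<in> {1..?n}" and "?L i j = ?L i j'"
      then have "int ?n dvd g (j - 1) - g (j' - 1)"
        using additive_array_eqD[OF n] by fastforce
      with g[of "j - 1" "j' - 1"] have "j - 1 = j' - 1" using jj by auto
      then show "j = j'" using jj by auto
    qed
  qed (use additive_array_range[OF n] in auto)
  have col: "bij_betw (\<lambda>i. ?L i j) {1..?n} {1..?n}" for j
  proof (rule bij_betw_if_inj_on_card_le)
    show "inj_on (\<lambda>i. ?L i j) {1..?n}"
    proof (rule inj_onI)
      fix i i' assume ii: "i \<in> {1..?n}" "i' \<in> {1..?n}" and "?L i j = ?L i' j"
      then have "int ?n dvd f (i - 1) - f (i' - 1)"
        using additive_array_eqD[OF n] by fastforce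
      with f[of "i - 1" "i' - 1"] have "i - 1 = i' - 1" using ii by auto
      then show "i = i'" using ii by auto
    qed
  qed (use additive_array_range[OF n] in auto)
  have quotient: "(x - 1) div c = k" if "x \<in> {k * c + 1..(k + 1) * c}" for x c k :: nat
    using that by (intro div_nat_eqI) (auto simp: algebra_simps)
  have blk: "bij_betw (\<lambda>(i, j). ?L i j)
      ({k * a + 1..(k + 1) * a} \<times> {l * b + 1..(l + 1) * b}) {1..?n}" for k l
  proof (rule bij_betw_if_inj_on_card_le)
    show "inj_on (\<lambda>(i, j). ?L i j) ({k * a + 1..(k + 1) * a} \<times> {l * b + 1..(l + 1) * b})"
    proof (rule inj_onI, clarify)
      fix i j i' j'
      assume cells: "i \<in> {k * a + 1..(k + 1) * a}" "j \<in> {l * b + 1..(l + 1) * b}"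
          "i' \<in> {k * a + 1..(k + 1) * a}" "j' \<in> {l * b + 1..(l + 1) * b}"
        and "?L i j = ?L i' j'"
      then have "i - 1 = i' - 1 \<and> j - 1 = j' - 1"
        using block additive_array_eqD[OF n] quotient by metis
      then show "i = i' \<and> j = j'" using cells by auto
    qed
    show "card {1..?n} \<le> card ({k * a + 1..(k + 1) * a} \<times> {l * b + 1..(l + 1) * b})"
      by (simp add: card_cartesian_product)
  qed (use additive_array_range[OF n] in auto)
  show ?thesis
    unfolding sudoku_latin_square_def latin_square_def using row col blk by blast
qed

lemma le_inner_distance_additive_array:
  assumes n: "n \<ge> 2" and d: "0 < d"
    and f: "\<And>i. f (Suc i) - f i \<in> {int d..int n - int d}"
    and g: "\<And>j. g (Suc j) - g j \<in> {int d..int n - int d}"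
  shows "d \<le> inner_distance n (additive_array n f g)"
proof -
  have step: "d \<le> symbol_dist n (nat (p mod int n) + 1) (nat (q mod int n) + 1)"
    if "q - p \<in> {int d..int n - int d}" for p q
  proof -
    have "(int (nat (q mod int n) + 1) - int (nat (p mod int n) + 1)) mod int n = (q - p) mod int n"
      using n by (simp add: mod_diff_eq)
    also have "\<dots> = q - p"
      using that d by (intro mod_pos_pos_trivial) auto
    finally show ?thesis using that by (subst le_symbol_dist_iff[OF d]) auto
  qed
  show ?thesis
  proof (rule le_inner_distance[OF n])
    fix i j assume "i \<in> {1..n}" "j \<in> {1..<n}"
    then show "d \<le> symbol_dist n (additive_array n f g i j) (additive_array n f g i (j + 1))"
      unfolding additive_array_def using g[of "j - 1"] by (intro step) auto
  next
    fix i j assume "i \<in> {1..<n}" "j \<in> {1..n}"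
    then show "d \<le> symbol_dist n (additive_array n f g i j) (additive_array n f g (i + 1) j)"
      unfolding additive_array_def using f[of "i - 1"] by (intro step) auto
  qed
qed

section \<open>The two constructions\<close>

lemma div_Suc_cases:
  "Suc i div c = i div c \<or> Suc i div c = Suc (i div c)"
  by (simp add: div_Suc)

lemma eq_if_div_eq_dvd:
  fixes i i' c :: nat
  assumes "i div c = i' div c" "int c dvd int i - int i'"
  shows "i = i'"
proof -
  have "i mod c = i' mod c"
    using assms(2) by (metis mod_eq_dvd_iff of_nat_eq_iff zmod_int)
  then show ?thesis using assms(1) by (metis div_mult_mod_eq)
qed

text \<open>
  Every injectivity claim becomes transparent after multiplication by \<open>-2\<close>, which turns \<open>m\<close> into 1
  and \<open>m - 1\<close> into 3 modulo \<open>n = 2 m + 1\<close>. Reducing modulo 3 then isolates the block index for \<open>g\<close>,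
  and the row within its band for a block; what remains is a multiple of 3, which determines the
  column modulo \<open>b\<close>.
\<close>

lemma ex_sudoku_3_odd:
  assumes "b \<ge> 3" "odd b"
  shows "\<exists>L. sudoku_latin_square 3 b L \<and> (3 * b - 3) div 2 \<le> inner_distance (3 * b) L"
proof -
  define m where "m = (int (3 * b) - 1) div 2"
  have n: "int (3 * b) = 2 * m + 1" using assms(2) unfolding m_def by auto
  define f where "f = (\<lambda>i::nat. m * int i)"
  define g where "g = (\<lambda>j::nat. (m - 1) * int j + int (j div b))"
  \<comment> \<open>The multiplication by \<open>-2\<close>.\<close>
  have twist: "int (3 * b) dvd x + 3 * y - 2 * z" if "int (3 * b) dvd m * x + (m - 1) * y + z"
    for x y z
  proof -
    have "x + 3 * y - 2 * z = int (3 * b) * (x + y) - 2 * (m * x + (m - 1) * y + z)"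
      unfolding n by (simp add: algebra_simps)
    then show ?thesis using that by (metis dvd_diff dvd_mult dvd_triv_left)
  qed
  have three: "3 dvd int (3 * b)" by simp
  have cancel3: "int b dvd y" if "int (3 * b) dvd 3 * y" for y
    using that by (simp add: dvd_mult_cancel_left)
  have "sudoku_latin_square 3 b (additive_array (3 * b) f g)"
  proof (rule additive_array_sudoku)
    fix i i' assume ii: "i < 3 * b" "i' < 3 * b" "int (3 * b) dvd f i - f i'"
    then have "int (3 * b) dvd int i - int i'"
      using twist[of "int i - int i'" 0 0] by (simp add: f_def algebra_simps)
    then show "i = i'" using ii eq_if_div_eq_dvd[of i "3 * b" i'] by simp
  next
    fix j j' assume jj: "j < 3 * b" "j' < 3 * b" "int (3 * b) dvd g j - g j'"
    define z where "z = int (j div b) - int (j' div b)"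
    have "g j - g j' = m * 0 + (m - 1) * (int j - int j') + z"
      by (simp add: g_def z_def algebra_simps)
    then have tw: "int (3 * b) dvd 3 * (int j - int j') - 2 * z"
      using jj(3) twist[of 0 "int j - int j'" z] by simp
    then have "3 dvd 3 * (int j - int j') - 2 * z" using three dvd_trans by blast
    then have "3 dvd z" by presburger
    moreover have "j div b < 3" "j' div b < 3"
      using jj assms(1) by (simp_all add: div_less_iff_less_mult)
    then have "\<bar>z\<bar> < 3" unfolding z_def by linarith
    ultimately have z: "z = 0" using dvd_imp_le_int by fastforce
    then have "j div b = j' div b" by (simp add: z_def)
    moreover have "int b dvd int j - int j'"
      using tw unfolding z by (intro cancel3) (simp only: mult_zero_right diff_0_right)
    ultimately show "j = j'" using eq_if_div_eq_dvd by blast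
  next
    fix i j i' j' :: nat
    assume div: "i div 3 = i' div 3" "j div b = j' div b"
      and "int (3 * b) dvd (f i - f i') + (g j - g j')"
    moreover have "(f i - f i') + (g j - g j')
        = m * (int i - int i') + (m - 1) * (int j - int j') + 0"
      using div by (simp add: f_def g_def algebra_simps)
    ultimately have tw: "int (3 * b) dvd (int i - int i') + 3 * (int j - int j')"
      using twist[of "int i - int i'" "int j - int j'" 0] by simp
    then have "3 dvd (int i - int i') + 3 * (int j - int j')" using three dvd_trans by blast
    then have "3 dvd int i - int i'" by presburger
    then have i: "i = i'" using div eq_if_div_eq_dvd[of i 3 i'] by simp
    then have "int b dvd int j - int j'"
      using tw by (intro cancel3) (simp only: diff_self add_0)
    then show "i = i' \<and> j = j'" using i div eq_if_div_eq_dvd by blast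
  qed (use assms in auto)
  moreover have "(3 * b - 3) div 2 \<le> inner_distance (3 * b) (additive_array (3 * b) f g)"
  proof (rule le_inner_distance_additive_array)
    have d: "int ((3 * b - 3) div 2) = m - 1" using assms(1) n by linarith
    have fstep: "f (Suc i) - f i = m" for i
      by (simp add: f_def algebra_simps)
    show "f (Suc i) - f i \<in> {int ((3 * b - 3) div 2)..int (3 * b) - int ((3 * b - 3) div 2)}" for i
      unfolding fstep d n using n assms(1) by auto
    have gstep: "g (Suc j) - g j \<in> {m - 1, m}" for j
      using div_Suc_cases[of j b] by (auto simp: g_def algebra_simps)
    show "g (Suc j) - g j \<in> {int ((3 * b - 3) div 2)..int (3 * b) - int ((3 * b - 3) div 2)}" for j
      unfolding d n using gstep[of j] n assms(1) by auto
  qed (use assms(1) in auto)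
  ultimately show ?thesis by blast
qed

text \<open>
  Reducing modulo 4 removes the steps 4 of \<open>f\<close>. This isolates the block index for \<open>f\<close>, and the
  column within its stack for a block; what remains is a multiple of 4, which determines the row
  modulo 3.
\<close>

lemma ex_sudoku_3_4:
  "\<exists>L. sudoku_latin_square 3 4 L \<and> 4 \<le> inner_distance 12 L"
proof -
  define f where "f = (\<lambda>i::nat. 4 * int i + int (i div 3))"
  define g where "g = (\<lambda>j::nat. 5 * int j)"
  have "sudoku_latin_square 3 4 (additive_array (3 * 4) f g)"
  proof (rule additive_array_sudoku)
    fix i i' :: nat assume ii: "i < 3 * 4" "i' < 3 * 4" "int (3 * 4) dvd f i - f i'"
    define z where "z = int (i div 3) - int (i' div 3)"
    have eq: "f i - f i' = 4 * (int i - int i') + z" by (simp add: f_def z_def)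
    then have "4 dvd z" using ii(3) by simp presburger
    moreover have "i div 3 < 4" "i' div 3 < 4" using ii by auto
    then have "\<bar>z\<bar> < 4" unfolding z_def by linarith
    ultimately have z: "z = 0" using dvd_imp_le_int by fastforce
    have "3 dvd int i - int i'" using ii(3) unfolding eq z by simp presburger
    then show "i = i'" using z eq_if_div_eq_dvd[of i 3 i'] by (simp add: z_def)
  next
    fix j j' :: nat assume jj: "j < 3 * 4" "j' < 3 * 4" "int (3 * 4) dvd g j - g j'"
    then have "12 dvd int j - int j'" unfolding g_def by simp presburger
    then show "j = j'" using jj eq_if_div_eq_dvd[of j 12 j'] by simp
  next
    fix i j i' j' :: nat
    assume div: "i div 3 = i' div 3" "j div 4 = j' div 4"
      and "int (3 * 4) dvd (f i - f i') + (g j - g j')"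
    then have dvd: "12 dvd 4 * (int i - int i') + 5 * (int j - int j')"
      by (simp add: f_def g_def algebra_simps)
    then have "4 dvd int j - int j'" by presburger
    then have j: "j = j'" using div eq_if_div_eq_dvd[of j 4 j'] by simp
    then have "3 dvd int i - int i'" using dvd by presburger
    then show "i = i' \<and> j = j'" using j div eq_if_div_eq_dvd[of i 3 i'] by simp
  qed auto
  moreover have "4 \<le> inner_distance 12 (additive_array 12 f g)"
  proof (rule le_inner_distance_additive_array)
    show "f (Suc i) - f i \<in> {int 4..int 12 - int 4}" for i
      using div_Suc_cases[of i 3] by (auto simp: f_def)
    show "g (Suc j) - g j \<in> {int 4..int 12 - int 4}" for j
      by (simp add: g_def)
  qed auto
  ultimately show ?thesis by auto
qed

section \<open>The value of \<open>MiD\<close>\<close>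

lemma MiD_eqI:
  assumes "\<And>L. sudoku_latin_square a b L \<Longrightarrow> inner_distance (a * b) L \<le> d"
    and "\<exists>L. sudoku_latin_square a b L \<and> d \<le> inner_distance (a * b) L"
  shows "MiD a b = d"
  unfolding MiD_def
proof (rule Max_eqI)
  show "finite {inner_distance (a * b) L | L. sudoku_latin_square a b L}"
    by (rule finite_subset[of _ "{..d}"]) (use assms(1) in auto)
  show "d \<in> {inner_distance (a * b) L | L. sudoku_latin_square a b L}"
    using assms by (metis (mono_tags, lifting) antisym mem_Collect_eq)
qed (use assms(1) in auto)

theorem theorem4p12:
  fixes b n :: nat
  assumes "(b \<ge> 3 \<and> odd b) \<or> b = 4"
    and "n = 3 * b"
  shows "int (MiD 3 b) = \<lfloor>(real n - 3) / 2\<rfloor>"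
proof -
  have b: "b \<ge> 3" using assms(1) by auto
  have "MiD 3 b = (3 * b - 3) div 2"
  proof (rule MiD_eqI)
    show "inner_distance (3 * b) L \<le> (3 * b - 3) div 2" if "sudoku_latin_square 3 b L" for L
      using inner_distance_sudoku_le[OF that] b by simp
    show "\<exists>L. sudoku_latin_square 3 b L \<and> (3 * b - 3) div 2 \<le> inner_distance (3 * b) L"
      using assms(1) ex_sudoku_3_odd ex_sudoku_3_4 by auto
  qed
  moreover have "\<lfloor>(real n - 3) / 2\<rfloor> = int ((n - 3) div 2)"
    using b assms(2) floor_divide_of_nat_eq[of "n - 3" 2, where ?'a = real]
    by (simp add: of_nat_diff)
  ultimately show ?thesis using assms(2) by simp
qed

end
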